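(* Let $\mathbf{r}(t)$ be a rational helix with rational unit tangent field $\mathbf{t}(t)$, with $\mathbf{t}'(t)\neq 0$ for all $t$, and let $\mathbf{u}$ be a constant unit vector and $\psi\in(0,\pi)$ the constant angle with $\mathbf{t}(t)\cdot\mathbf{u}=\cos\psi$ for all $t$; write $\mathbf{r}(t)=a_1(t)\,\mathbf{t}(t)+a_2(t)\,\mathbf{w}_2(t)+a_3(t)\,\mathbf{w}_3(t)$ with $\mathbf{w}_2=\frac{1}{\sin\psi}\mathbf{u}\times\mathbf{t}$ and $\mathbf{w}_3=\mathbf{t}\times\mathbf{w}_2$. Then $\mathbf{r}(t)$ has a rational rotation minimizing frame (RRMF) if and only if there exist relatively prime polynomials $a(t)$ and $b(t)$ satisfying $$\frac{a(t)\,b'(t)-a'(t)\,b(t)}{a^2(t)+b^2(t)}=\frac{1}{2}\cot\psi\,|\mathbf{t}'(t)|.$$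
   Context: All functions are functions of a real parameter $t$ (ranging over an interval on which they are defined and $\mathbf{r}'\neq 0$), and $'$ denotes $d/dt$. Polynomials have real coefficients; rational functions, vector fields and curves have (component) functions that are quotients of real polynomials in $t$. A rational helix is a rational curve $\mathbf{r}(t)$ in $\mathbb{R}^3$ whose unit tangent $\mathbf{t}(t)=\mathbf{r}'(t)/|\mathbf{r}'(t)|$ makes a constant angle $\psi$ with a constant unit vector $\mathbf{u}$. An adapted frame along $\mathbf{r}(t)$ is an orthonormal basis $(\mathbf{f}_1(t),\mathbf{f}_2(t),\mathbf{f}_3(t))$ of $\mathbb{R}^3$, depending smoothly on $t$, with $\mathbf{f}_1(t)=\mathbf{t}(t)$. It is a rotation minimizing frame (RMF) if $\mathbf{f}_2'(t)\cdot\mathbf{f}_3(t)\equiv 0$, and a rational rotation minimizing frame (RRMF) if moreover $\mathbf{f}_1,\mathbf{f}_2,\mathbf{f}_3$ are rational vector fields. *)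

theory Defs
  imports "HOL-Analysis.Analysis" "HOL-Computational_Algebra.Polynomial_Factorial"
begin

text \<open>
  All functions live on a nondegenerate interval \<open>I\<close>, which may contain its endpoints. Derivatives
  are therefore taken within \<open>I\<close>, and values outside \<open>I\<close> are irrelevant.
\<close>

definition rational_on :: "real set \<Rightarrow> (real \<Rightarrow> real) \<Rightarrow> bool" where
  "rational_on I g \<longleftrightarrow>
     (\<exists>p q :: real poly. \<forall>t\<in>I. poly q t \<noteq> 0 \<and> g t = poly p t / poly q t)"

definition rational_vec_on :: "real set \<Rightarrow> (real \<Rightarrow> real^3) \<Rightarrow> bool" where
  "rational_vec_on I f \<longleftrightarrow> (\<forall>i. rational_on I (\<lambda>t. f t $ i))"

text \<open>\<open>C\<^sup>\<infinity>\<close> smoothness on \<open>I\<close>; \<open>D n\<close> is the \<open>n\<close>-th derivative.\<close>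

definition smooth_vec_on :: "real set \<Rightarrow> (real \<Rightarrow> real^3) \<Rightarrow> bool" where
  "smooth_vec_on I f \<longleftrightarrow>
     (\<exists>D :: nat \<Rightarrow> real \<Rightarrow> real^3.
        (\<forall>t\<in>I. D 0 t = f t) \<and>
        (\<forall>n. \<forall>t\<in>I. (D n has_vector_derivative D (Suc n) t) (at t within I)))"

definition deriv_on :: "real set \<Rightarrow> (real \<Rightarrow> real^3) \<Rightarrow> real \<Rightarrow> real^3" where
  "deriv_on I f t = vector_derivative f (at t within I)"

definition unit_tangent :: "real set \<Rightarrow> (real \<Rightarrow> real^3) \<Rightarrow> real \<Rightarrow> real^3" where
  "unit_tangent I r t = deriv_on I r t /\<^sub>R norm (deriv_on I r t)"

definition rational_helix :: "real set \<Rightarrow> (real \<Rightarrow> real^3) \<Rightarrow> bool" where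
  "rational_helix I r \<longleftrightarrow>
     rational_vec_on I r \<and> (\<forall>t\<in>I. deriv_on I r t \<noteq> 0) \<and>
     (\<exists>u \<psi>. norm u = 1 \<and> (\<forall>t\<in>I. unit_tangent I r t \<bullet> u = cos \<psi>))"

text \<open>Three orthonormal vectors form a basis of \<open>\<real>\<^sup>3\<close>; no orientation is prescribed.\<close>

definition adapted_frame ::
  "real set \<Rightarrow> (real \<Rightarrow> real^3) \<Rightarrow> (real \<Rightarrow> real^3) \<Rightarrow> (real \<Rightarrow> real^3) \<Rightarrow> (real \<Rightarrow> real^3) \<Rightarrow> bool" where
  "adapted_frame I r f1 f2 f3 \<longleftrightarrow>
     smooth_vec_on I f1 \<and> smooth_vec_on I f2 \<and> smooth_vec_on I f3 \<and>
     (\<forall>t\<in>I. norm (f1 t) = 1 \<and> norm (f2 t) = 1 \<and> norm (f3 t) = 1 \<and>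
            f1 t \<bullet> f2 t = 0 \<and> f1 t \<bullet> f3 t = 0 \<and> f2 t \<bullet> f3 t = 0 \<and>
            f1 t = unit_tangent I r t)"

definition is_RMF ::
  "real set \<Rightarrow> (real \<Rightarrow> real^3) \<Rightarrow> (real \<Rightarrow> real^3) \<Rightarrow> (real \<Rightarrow> real^3) \<Rightarrow> (real \<Rightarrow> real^3) \<Rightarrow> bool" where
  "is_RMF I r f1 f2 f3 \<longleftrightarrow>
     adapted_frame I r f1 f2 f3 \<and> (\<forall>t\<in>I. deriv_on I f2 t \<bullet> f3 t = 0)"

definition is_RRMF ::
  "real set \<Rightarrow> (real \<Rightarrow> real^3) \<Rightarrow> (real \<Rightarrow> real^3) \<Rightarrow> (real \<Rightarrow> real^3) \<Rightarrow> (real \<Rightarrow> real^3) \<Rightarrow> bool" where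
  "is_RRMF I r f1 f2 f3 \<longleftrightarrow>
     is_RMF I r f1 f2 f3 \<and> rational_vec_on I f1 \<and> rational_vec_on I f2 \<and> rational_vec_on I f3"

definition has_RRMF :: "real set \<Rightarrow> (real \<Rightarrow> real^3) \<Rightarrow> bool" where
  "has_RRMF I r \<longleftrightarrow> (\<exists>f1 f2 f3. is_RRMF I r f1 f2 f3)"

text \<open>The vectors \<open>w\<^sub>2\<close>, \<open>w\<^sub>3\<close> attached to a tangent vector \<open>v\<close>, an axis \<open>u\<close> and an angle \<open>\<psi>\<close>.\<close>

definition helix_w2 :: "real^3 \<Rightarrow> real \<Rightarrow> real^3 \<Rightarrow> real^3" where
  "helix_w2 u \<psi> v = (1 / sin \<psi>) *\<^sub>R cross3 u v"

definition helix_w3 :: "real^3 \<Rightarrow> real \<Rightarrow> real^3 \<Rightarrow> real^3" where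
  "helix_w3 u \<psi> v = cross3 v (helix_w2 u \<psi> v)"

end

theory Submission
  imports Defs "HOL-Computational_Algebra.Field_as_Ring"
begin

text \<open>
  Write \<open>T\<close> for the unit tangent. Since \<open>T \<bullet> T\<close> and \<open>T \<bullet> u\<close> are constant, \<open>T'\<close> is orthogonal to
  \<open>T\<close> and to \<open>u\<close>, hence a multiple \<open>T' = k w\<^sub>2\<close>; as \<open>T'\<close> never vanishes on the interval, the
  continuous function \<open>k\<close> has constant sign and \<open>\<bar>T'\<bar> = \<plusminus>k\<close>. The relation
  \<open>u = cos \<psi> T + sin \<psi> w\<^sub>3\<close> then gives \<open>w\<^sub>3' = - k cot \<psi> w\<^sub>2\<close> and \<open>w\<^sub>2' = k (cot \<psi> w\<^sub>3 - T)\<close>: relative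
  to a rotation minimizing frame, the frame \<open>(T, w\<^sub>2, w\<^sub>3)\<close> turns about \<open>T\<close> at the rate \<open>k cot \<psi>\<close>.

  The fields \<open>w\<^sub>2\<close> and \<open>w\<^sub>3\<close> are rational with \<open>T\<close>. The second vector of an adapted frame is
  \<open>c w\<^sub>2 + d w\<^sub>3\<close> with \<open>c\<^sup>2 + d\<^sup>2 = 1\<close>; it is rational exactly if \<open>c\<close> and \<open>d\<close> are, and it is rotation
  minimizing exactly if \<open>c d' - d c' = - k cot \<psi>\<close> (lemma \<open>rotation_rate\<close>). So a rational rotation
  minimizing frame amounts to a rational motion on the unit circle with prescribed angular velocity
  (lemma \<open>RRMF_iff_pythagorean\<close>).

  It remains to parametrize the circle rationally. With \<open>(c, d) = (cos \<theta>, sin \<theta>)\<close>, the half-angle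
  formula \<open>tan (\<theta> / 2) = d / (1 + c)\<close> makes \<open>tan (\<theta> / 2)\<close> a quotient \<open>b / a\<close> of coprime polynomials,
  and conversely \<open>c = (a\<^sup>2 - b\<^sup>2) / (a\<^sup>2 + b\<^sup>2)\<close> and \<open>d = 2 a b / (a\<^sup>2 + b\<^sup>2)\<close>. Since
  \<open>\<theta>' = 2 (a b' - a' b) / (a\<^sup>2 + b\<^sup>2)\<close>, the condition becomes the one of the theorem up to the sign
  of its right-hand side, and replacing \<open>b\<close> by \<open>- b\<close> corrects that sign.
\<close>

section \<open>Rational functions and fields\<close>

lemma rational_on_const: "rational_on I (\<lambda>t. c)"
  unfolding rational_on_def by (rule exI[of _ "[:c:]"], rule exI[of _ 1]) simp

lemma rational_on_add:
  assumes "rational_on I f" "rational_on I g"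
  shows "rational_on I (\<lambda>t. f t + g t)"
proof -
  obtain p q where f: "\<And>t. t \<in> I \<Longrightarrow> poly q t \<noteq> 0 \<and> f t = poly p t / poly q t"
    using assms(1) unfolding rational_on_def by auto
  obtain p' q' where g: "\<And>t. t \<in> I \<Longrightarrow> poly q' t \<noteq> 0 \<and> g t = poly p' t / poly q' t"
    using assms(2) unfolding rational_on_def by auto
  show ?thesis
    unfolding rational_on_def
    by (rule exI[of _ "p * q' + p' * q"], rule exI[of _ "q * q'"]) (simp add: f g add_frac_eq)
qed

lemma rational_on_mult:
  assumes "rational_on I f" "rational_on I g"
  shows "rational_on I (\<lambda>t. f t * g t)"
proof -
  obtain p q where f: "\<And>t. t \<in> I \<Longrightarrow> poly q t \<noteq> 0 \<and> f t = poly p t / poly q t"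
    using assms(1) unfolding rational_on_def by auto
  obtain p' q' where g: "\<And>t. t \<in> I \<Longrightarrow> poly q' t \<noteq> 0 \<and> g t = poly p' t / poly q' t"
    using assms(2) unfolding rational_on_def by auto
  show ?thesis
    unfolding rational_on_def
    by (rule exI[of _ "p * p'"], rule exI[of _ "q * q'"]) (auto simp: f g)
qed

lemma rational_on_diff:
  assumes "rational_on I f" "rational_on I g"
  shows "rational_on I (\<lambda>t. f t - g t)"
  using rational_on_add[OF assms(1) rational_on_mult[OF rational_on_const[of I "- 1"] assms(2)]]
  by simp

lemma rational_on_poly_divide:
  assumes "\<And>t. t \<in> I \<Longrightarrow> poly q t \<noteq> 0"
  shows "rational_on I (\<lambda>t. poly p t / poly q t)"
  unfolding rational_on_def by (rule exI[of _ p], rule exI[of _ q]) (simp add: assms)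

lemma rational_on_common_denominator:
  assumes "rational_on I f" "rational_on I g"
  shows "\<exists>p1 p2 q. \<forall>t\<in>I. poly q t \<noteq> 0 \<and> f t = poly p1 t / poly q t \<and> g t = poly p2 t / poly q t"
proof -
  obtain p q where f: "\<And>t. t \<in> I \<Longrightarrow> poly q t \<noteq> 0 \<and> f t = poly p t / poly q t"
    using assms(1) unfolding rational_on_def by auto
  obtain p' q' where g: "\<And>t. t \<in> I \<Longrightarrow> poly q' t \<noteq> 0 \<and> g t = poly p' t / poly q' t"
    using assms(2) unfolding rational_on_def by auto
  show ?thesis
    by (rule exI[of _ "p * q'"], rule exI[of _ "p' * q"], rule exI[of _ "q * q'"]) (simp add: f g)
qed

lemma rational_vec_on_const: "rational_vec_on I (\<lambda>t. v)"
  unfolding rational_vec_on_def by (simp add: rational_on_const)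

lemma rational_vec_on_add:
  assumes "rational_vec_on I f" "rational_vec_on I g"
  shows "rational_vec_on I (\<lambda>t. f t + g t)"
  using assms unfolding rational_vec_on_def by (simp add: rational_on_add)

lemma rational_vec_on_scaleR:
  assumes "rational_on I c" "rational_vec_on I f"
  shows "rational_vec_on I (\<lambda>t. c t *\<^sub>R f t)"
  using assms unfolding rational_vec_on_def by (simp add: rational_on_mult)

lemma rational_on_inner:
  assumes "rational_vec_on I f" "rational_vec_on I g"
  shows "rational_on I (\<lambda>t. f t \<bullet> g t)"
  using assms unfolding rational_vec_on_def inner_vec_def sum_3
  by (simp add: rational_on_add rational_on_mult)

lemma rational_vec_on_cross3:
  assumes "rational_vec_on I f" "rational_vec_on I g"
  shows "rational_vec_on I (\<lambda>t. cross3 (f t) (g t))"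
  using assms unfolding rational_vec_on_def
  by (simp add: forall_3 cross_components rational_on_diff rational_on_mult)

lemma has_real_derivative_poly_divide:
  assumes "poly q t \<noteq> 0"
  shows "((\<lambda>x. poly p x / poly q x) has_real_derivative
           (poly (pderiv p) t * poly q t - poly p t * poly (pderiv q) t) / (poly q t)\<^sup>2)
         (at t within S)"
proof -
  have "((\<lambda>x. poly p x / poly q x) has_real_derivative
           (poly (pderiv p) t * poly q t - poly p t * poly (pderiv q) t) / (poly q t * poly q t))
         (at t)"
    using assms by (intro DERIV_divide poly_DERIV)
  then show ?thesis
    by (auto simp: power2_eq_square intro: has_field_derivative_at_within)
qed

text \<open>
  The quotient rule maps a pair (numerator, denominator) to such a pair without creating new
  poles. Iterating this map on pairs yields all higher derivatives at once.
\<close>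

lemma rational_on_derivatives:
  assumes "rational_on I g"
  shows "\<exists>D :: nat \<Rightarrow> real \<Rightarrow> real. (\<forall>t\<in>I. D 0 t = g t) \<and>
           (\<forall>n. \<forall>t\<in>I. (D n has_real_derivative D (Suc n) t) (at t within I))"
proof -
  obtain p q where pq: "\<And>t. t \<in> I \<Longrightarrow> poly q t \<noteq> 0 \<and> g t = poly p t / poly q t"
    using assms unfolding rational_on_def by auto
  define step :: "real poly \<times> real poly \<Rightarrow> real poly \<times> real poly"
    where "step = (\<lambda>(a, b). (pderiv a * b - a * pderiv b, b ^ 2))"
  define F where "F n = (step ^^ n) (p, q)" for n
  define D where "D n t = poly (fst (F n)) t / poly (snd (F n)) t" for n t
  have F_Suc: "F (Suc n) = (pderiv (fst (F n)) * snd (F n) - fst (F n) * pderiv (snd (F n)),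
                            snd (F n) ^ 2)" for n
    by (simp add: F_def step_def case_prod_beta)
  have nz: "poly (snd (F n)) t \<noteq> 0" if "t \<in> I" for n t
  proof (induction n)
    case 0
    show ?case
      using pq[OF that] by (simp add: F_def)
  next
    case (Suc n)
    then show ?case
      by (simp add: F_Suc)
  qed
  show ?thesis
  proof (intro exI[of _ D] conjI ballI allI)
    fix t assume t: "t \<in> I"
    show "D 0 t = g t"
      using pq t by (simp add: D_def F_def)
    fix n
    show "(D n has_real_derivative D (Suc n) t) (at t within I)"
      unfolding D_def using has_real_derivative_poly_divide[OF nz[OF t, of n]]
      by (simp add: F_Suc)
  qed
qed

lemma smooth_vec_on_if_rational:
  assumes "rational_vec_on I f"
  shows "smooth_vec_on I f"
proof -
  have "\<forall>i. \<exists>D :: nat \<Rightarrow> real \<Rightarrow> real. (\<forall>t\<in>I. D 0 t = f t $ i) \<and>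
           (\<forall>n. \<forall>t\<in>I. (D n has_real_derivative D (Suc n) t) (at t within I))"
    using assms rational_on_derivatives unfolding rational_vec_on_def by blast
  then obtain D :: "3 \<Rightarrow> nat \<Rightarrow> real \<Rightarrow> real" where
    D0: "\<And>i t. t \<in> I \<Longrightarrow> D i 0 t = f t $ i" and
    D: "\<And>i n t. t \<in> I \<Longrightarrow> (D i n has_real_derivative D i (Suc n) t) (at t within I)"
    by metis
  have vec: "(\<Sum>i\<in>UNIV. c i *\<^sub>R axis i 1) = (\<chi> i. c i)" for c :: "3 \<Rightarrow> real"
    by (simp add: vec_eq_iff forall_3 sum_3 axis_def)
  have "((\<lambda>t. \<chi> i. D i n t) has_vector_derivative (\<chi> i. D i (Suc n) t)) (at t within I)"
    if "t \<in> I" for n t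
  proof -
    have "((\<lambda>t. D i n t *\<^sub>R axis i (1::real)) has_vector_derivative D i (Suc n) t *\<^sub>R axis i 1)
            (at t within I)" for i
      using has_vector_derivative_scaleR[OF D[OF that] has_vector_derivative_const] by simp
    then have "((\<lambda>t. \<Sum>i\<in>UNIV. D i n t *\<^sub>R axis i (1::real)) has_vector_derivative
            (\<Sum>i\<in>UNIV. D i (Suc n) t *\<^sub>R axis i 1)) (at t within I)"
      by (intro has_vector_derivative_sum)
    then show ?thesis
      by (simp only: vec)
  qed
  then show ?thesis
    unfolding smooth_vec_on_def
    by (intro exI[of _ "\<lambda>n t. \<chi> i. D i n t"]) (simp add: D0 vec_eq_iff)
qed

lemma poly_eq_if_eq_on_infinite:
  fixes p q :: "real poly"
  assumes "infinite S" "\<And>t. t \<in> S \<Longrightarrow> poly p t = poly q t"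
  shows "p = q"
proof (rule ccontr)
  assume "p \<noteq> q"
  then have "finite {t. poly (p - q) t = 0}"
    by (intro poly_roots_finite) simp
  moreover have "S \<subseteq> {t. poly (p - q) t = 0}"
    using assms(2) by auto
  ultimately show False
    using assms(1) finite_subset by blast
qed

section \<open>The half-angle substitution for polynomials\<close>

text \<open>
  The quotient \<open>b / a\<close> is \<open>R / (Q + P)\<close> in lowest terms, that is, \<open>tan (\<theta> / 2)\<close> for the angle with
  cosine \<open>P / Q\<close> and sine \<open>R / Q\<close>. The conclusion says that \<open>2 (a b' - a' b) / (a\<^sup>2 + b\<^sup>2)\<close> is the
  derivative of \<open>\<theta>\<close>. As an identity between polynomials, free of division, it also covers the
  points where \<open>\<theta>\<close> is an odd multiple of \<open>\<pi>\<close> and the half-angle tangent is infinite.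
\<close>

lemma half_angle_polynomials:
  fixes P R Q :: "real poly"
  assumes pyth: "P\<^sup>2 + R\<^sup>2 = Q\<^sup>2"
  shows "\<exists>a b. coprime a b \<and>
           2 * (a * pderiv b - pderiv a * b) * Q\<^sup>2 = (P * pderiv R - pderiv P * R) * (a\<^sup>2 + b\<^sup>2)"
proof (cases "Q + P = 0")
  \<comment> \<open>Then \<open>R = 0\<close> and the angle is constantly \<open>\<pi>\<close>. Only its derivative \<open>0\<close> matters, and constants
    \<open>a\<close> and \<open>b\<close> produce that.\<close>
  case True
  then have "P = - Q"
    by (metis add.inverse_unique)
  then have "R = 0"
    using pyth by simp
  then show ?thesis
    by (intro exI[of _ 1] exI[of _ 0]) (simp add: pderiv_1)
next
  case False
  then have "gcd (Q + P) R \<noteq> 0"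
    by simp
  from gcd_coprime_exists[OF this] obtain a b where
    a: "Q + P = a * gcd (Q + P) R" and b: "R = b * gcd (Q + P) R" and cop: "coprime a b"
    by blast
  define g where "g = gcd (Q + P) R"
  have g: "g \<noteq> 0" and QP: "Q + P = a * g" and R: "R = b * g"
    unfolding g_def by (fact \<open>gcd (Q + P) R \<noteq> 0\<close> a b)+
  have "(a\<^sup>2 + b\<^sup>2) * g\<^sup>2 = (Q + P)\<^sup>2 + R\<^sup>2"
    unfolding QP R by (simp only: power_mult_distrib distrib_right)
  also have "\<dots> = Q\<^sup>2 + 2 * Q * P + (P\<^sup>2 + R\<^sup>2)"
    by (simp only: power2_sum add_ac mult_ac)
  also have "\<dots> = 2 * Q * (Q + P)"
    unfolding pyth by (simp add: power2_eq_square distrib_left)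
  finally have norm_sq: "(a\<^sup>2 + b\<^sup>2) * g\<^sup>2 = 2 * Q * (Q + P)" .
  have "pderiv (P\<^sup>2 + R\<^sup>2) = pderiv (Q\<^sup>2)"
    using pyth by simp
  then have "2 * (P * pderiv P + R * pderiv R) = 2 * (Q * pderiv Q)"
    by (simp add: power2_eq_square pderiv_add pderiv_mult algebra_simps)
  then have dpyth: "Q * pderiv Q - P * pderiv P = R * pderiv R"
    by (simp add: algebra_simps)
  define Z where "Z = P * pderiv R - pderiv P * R"
  define W where "W = a * pderiv b - pderiv a * b"
  have "(Q + P) * pderiv R - pderiv (Q + P) * R = W * g\<^sup>2"
    unfolding QP R W_def by (simp add: power2_eq_square pderiv_mult algebra_simps)
  then have wronskian: "W * g\<^sup>2 = (Q + P) * pderiv R - (pderiv Q + pderiv P) * R"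
    by (simp add: pderiv_add)
  \<comment> \<open>After multiplication by \<open>g\<^sup>2\<close> the claim no longer contains \<open>a\<close> and \<open>b\<close>: it relates \<open>P\<close>, \<open>R\<close>, \<open>Q\<close>
    only and follows from \<open>pyth\<close> and its derivative.\<close>
  have "Q * (W * g\<^sup>2) - Z * (Q + P)
          = pderiv R * (Q\<^sup>2 - P\<^sup>2) - R * (Q * pderiv Q - P * pderiv P)"
    unfolding wronskian Z_def by (simp add: power2_eq_square algebra_simps)
  also have "Q\<^sup>2 - P\<^sup>2 = R\<^sup>2"
    unfolding pyth[symmetric] by simp
  also have "pderiv R * R\<^sup>2 - R * (Q * pderiv Q - P * pderiv P) = 0"
    unfolding dpyth by (simp add: power2_eq_square mult_ac)
  finally have key: "Q * (W * g\<^sup>2) = Z * (Q + P)"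
    by simp
  have "2 * W * Q\<^sup>2 * g\<^sup>2 = 2 * Q * (Q * (W * g\<^sup>2))"
    by (simp only: power2_eq_square mult_ac)
  also have "\<dots> = Z * (2 * Q * (Q + P))"
    unfolding key by (simp only: mult_ac)
  also have "\<dots> = Z * (a\<^sup>2 + b\<^sup>2) * g\<^sup>2"
    unfolding norm_sq[symmetric] by (simp only: mult_ac)
  finally have "2 * (a * pderiv b - pderiv a * b) * Q\<^sup>2 * g\<^sup>2
          = (P * pderiv R - pderiv P * R) * (a\<^sup>2 + b\<^sup>2) * g\<^sup>2"
    unfolding W_def Z_def .
  then show ?thesis
    using g cop by auto
qed

text \<open>
  The angular velocity \<open>c d' - d c'\<close> of \<open>(c, d) = (p / q, r / q)\<close>: the derivative of the common
  denominator cancels.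
\<close>

lemma quotient_wronskian:
  fixes p p' r r' q q' :: real
  assumes "q \<noteq> 0"
  shows "(p / q) * ((r' * q - r * q') / q\<^sup>2) - (r / q) * ((p' * q - p * q') / q\<^sup>2)
           = (p * r' - p' * r) / q\<^sup>2"
  using assms by (simp add: field_simps power2_eq_square)

text \<open>A common real zero of \<open>a\<close> and \<open>b\<close> contradicts the Bezout identity.\<close>

lemma coprime_sum_squares_pos:
  fixes a b :: "real poly"
  assumes "coprime a b"
  shows "0 < (poly a t)\<^sup>2 + (poly b t)\<^sup>2"
proof -
  obtain x y where "x * a + y * b = 1"
    using assms by (metis bezout_coefficients_fst_snd coprime_iff_gcd_eq_1)
  then have "poly x t * poly a t + poly y t * poly b t = 1"
    by (metis poly_1 poly_add poly_mult)
  then have "poly a t \<noteq> 0 \<or> poly b t \<noteq> 0"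
    by auto
  then show ?thesis
    by (simp add: sum_power2_gt_zero_iff)
qed

section \<open>Orthonormal frames in three dimensions\<close>

lemma orthonormal_expansion_3:
  fixes e1 e2 e3 x :: "real^3"
  assumes "norm e1 = 1" "norm e2 = 1" "norm e3 = 1" "e1 \<bullet> e2 = 0" "e1 \<bullet> e3 = 0" "e2 \<bullet> e3 = 0"
  shows "x = (x \<bullet> e1) *\<^sub>R e1 + (x \<bullet> e2) *\<^sub>R e2 + (x \<bullet> e3) *\<^sub>R e3"
proof -
  let ?B = "{e1, e2, e3}"
  have sq: "e1 \<bullet> e1 = 1" "e2 \<bullet> e2 = 1" "e3 \<bullet> e3 = 1"
    using assms by (simp_all add: dot_square_norm)
  then have neq: "e1 \<noteq> e2" "e1 \<noteq> e3" "e2 \<noteq> e3"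
    using assms by auto
  have orth: "pairwise orthogonal ?B"
    using assms by (auto simp: pairwise_def orthogonal_def inner_commute)
  have "0 \<notin> ?B"
    using assms by auto
  then have "independent ?B"
    using orth by (rule pairwise_orthogonal_independent[rotated])
  moreover have "card ?B = 3"
    using neq by simp
  ultimately have "UNIV \<subseteq> span ?B"
    by (intro card_ge_dim_independent) (auto simp: dim_UNIV)
  then have "(\<Sum>b\<in>?B. (x \<bullet> b) *\<^sub>R b) = x"
    using orth assms by (intro orthonormal_basis_expand) auto
  then show ?thesis
    using neq by (simp add: add.assoc)
qed

lemma
  shows tangent_dot_helix_w2: "v \<bullet> helix_w2 u \<psi> v = 0"
    and tangent_dot_helix_w3: "v \<bullet> helix_w3 u \<psi> v = 0"
    and helix_w2_dot_w3: "helix_w2 u \<psi> v \<bullet> helix_w3 u \<psi> v = 0"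
  by (simp_all add: helix_w2_def helix_w3_def dot_cross_self cross_mult_right)

lemma
  fixes u v :: "real^3"
  assumes u: "norm u = 1" and v: "norm v = 1" and angle: "v \<bullet> u = cos \<psi>" and sin: "sin \<psi> \<noteq> 0"
  shows helix_axis_decomposition: "u = cos \<psi> *\<^sub>R v + sin \<psi> *\<^sub>R helix_w3 u \<psi> v"
    and norm_helix_w2: "norm (helix_w2 u \<psi> v) = 1"
    and norm_helix_w3: "norm (helix_w3 u \<psi> v) = 1"
proof -
  have sq: "u \<bullet> u = 1" "v \<bullet> v = 1" "u \<bullet> v = cos \<psi>"
    using u v angle by (simp_all add: dot_square_norm inner_commute)
  show "u = cos \<psi> *\<^sub>R v + sin \<psi> *\<^sub>R helix_w3 u \<psi> v"
    unfolding helix_w3_def helix_w2_def using sin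
    by (simp add: cross_mult_right Lagrange sq angle)
  have "(norm (cross3 u v))\<^sup>2 = (sin \<psi>)\<^sup>2"
    by (simp add: norm_cross u v sq sin_squared_eq)
  then have "norm (cross3 u v) = \<bar>sin \<psi>\<bar>"
    by (metis abs_norm_cancel power2_eq_iff_nonneg abs_ge_zero norm_ge_zero power2_abs)
  then show w2: "norm (helix_w2 u \<psi> v) = 1"
    using sin by (simp add: helix_w2_def)
  have "(norm (helix_w3 u \<psi> v))\<^sup>2 = 1"
    unfolding helix_w3_def by (simp add: norm_cross v w2 tangent_dot_helix_w2)
  then show "norm (helix_w3 u \<psi> v) = 1"
    by (simp add: power2_eq_1_iff) (smt (verit) norm_ge_zero)
qed

section \<open>The moving frame of a curve of constant slope\<close>

lemma has_vector_derivative_inner_constant: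
  fixes f g :: "real \<Rightarrow> 'a::real_inner"
  assumes "(f has_vector_derivative f') (at t within I)"
    and "(g has_vector_derivative g') (at t within I)"
    and "at t within I \<noteq> bot" "t \<in> I" "\<And>s. s \<in> I \<Longrightarrow> f s \<bullet> g s = c"
  shows "f' \<bullet> g t + f t \<bullet> g' = 0"
proof -
  have "((\<lambda>s. f s \<bullet> g s) has_vector_derivative f t \<bullet> g' + f' \<bullet> g t) (at t within I)"
    by (rule bounded_bilinear.has_vector_derivative[OF bounded_bilinear_inner assms(1,2)])
  moreover have "((\<lambda>s. f s \<bullet> g s) has_vector_derivative 0) (at t within I)"
    by (rule has_vector_derivative_transform[OF \<open>t \<in> I\<close> _ has_vector_derivative_const[of c]])
       (simp add: assms)
  ultimately show ?thesis
    using vector_derivative_within[OF assms(3)] by (metis add.commute)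
qed

lemma bounded_linear_helix_w2: "bounded_linear (helix_w2 u \<psi>)"
proof -
  have "linear (helix_w2 u \<psi>)"
    by (rule linearI)
       (simp_all add: helix_w2_def cross_add_right cross_mult_right scaleR_add_right)
  then show ?thesis
    by (simp add: linear_conv_bounded_linear)
qed

text \<open>
  Everything about frames depends on the curve only through its tangent field \<open>T\<close>, so the curve
  itself does not occur here.
\<close>

locale constant_slope =
  fixes I :: "real set" and T :: "real \<Rightarrow> real^3" and u :: "real^3" and \<psi> :: real
  assumes interval: "is_interval I" and nondegenerate: "interior I \<noteq> {}"
    and rational: "rational_vec_on I T"
    and unit: "\<And>t. t \<in> I \<Longrightarrow> norm (T t) = 1"
    and unit_axis: "norm u = 1"
    and angle_pos: "0 < \<psi>" and angle_less: "\<psi> < pi"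
    and slope: "\<And>t. t \<in> I \<Longrightarrow> T t \<bullet> u = cos \<psi>"
begin

abbreviation "w2 t \<equiv> helix_w2 u \<psi> (T t)"
abbreviation "w3 t \<equiv> helix_w3 u \<psi> (T t)"

text \<open>
  The factor \<open>k\<close> in \<open>T' = k w\<^sub>2\<close> (lemma \<open>tangent_deriv\<close>), a signed version of \<open>\<bar>T'\<bar>\<close>. Its sign
  enters the derivatives of \<open>w\<^sub>2\<close> and \<open>w\<^sub>3\<close> and thus the sense in which the frame turns.
\<close>

definition tangent_rate :: "real \<Rightarrow> real" where
  "tangent_rate t = deriv_on I T t \<bullet> w2 t"

lemma sin_nonzero: "sin \<psi> \<noteq> 0"
  using sin_gt_zero[OF angle_pos angle_less] by simp

lemma infinite_domain: "infinite I"
  using nondegenerate empty_interior_finite by blast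

lemma limit_nontrivial:
  assumes "t \<in> I"
  shows "at t within I \<noteq> bot"
proof -
  have "\<nexists>x. I = {x}"
    using infinite_domain by auto
  then have "t islimpt I"
    using assms interval by (intro connected_imp_perfect) (auto simp: is_interval_connected_1)
  then show ?thesis
    by (simp add: trivial_limit_within)
qed

lemma deriv_on_eqI:
  assumes "t \<in> I" "(f has_vector_derivative d) (at t within I)"
  shows "deriv_on I f t = d"
  unfolding deriv_on_def
  by (rule vector_derivative_within[OF limit_nontrivial[OF assms(1)] assms(2)])

lemma smooth_has_derivative:
  assumes "smooth_vec_on I f" "t \<in> I"
  shows "(f has_vector_derivative deriv_on I f t) (at t within I)"
proof -
  obtain D :: "nat \<Rightarrow> real \<Rightarrow> real^3" where D0: "\<And>t. t \<in> I \<Longrightarrow> D 0 t = f t"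
    and D: "\<And>n t. t \<in> I \<Longrightarrow> (D n has_vector_derivative D (Suc n) t) (at t within I)"
    using assms(1) unfolding smooth_vec_on_def by blast
  have "(f has_vector_derivative D (Suc 0) t) (at t within I)"
    by (rule has_vector_derivative_transform[OF assms(2) _ D[OF assms(2), of 0]])
       (simp add: D0)
  then show ?thesis
    using deriv_on_eqI[OF assms(2)] by simp
qed

lemma smooth_deriv_continuous:
  assumes "smooth_vec_on I f"
  shows "continuous_on I (deriv_on I f)"
proof -
  obtain D :: "nat \<Rightarrow> real \<Rightarrow> real^3" where D0: "\<And>t. t \<in> I \<Longrightarrow> D 0 t = f t"
    and D: "\<And>n t. t \<in> I \<Longrightarrow> (D n has_vector_derivative D (Suc n) t) (at t within I)"
    using assms(1) unfolding smooth_vec_on_def by blast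
  have "deriv_on I f t = D (Suc 0) t" if t: "t \<in> I" for t
    by (rule deriv_on_eqI[OF t],
        rule has_vector_derivative_transform[OF t _ D[OF t, of 0]]) (simp add: D0)
  moreover have "continuous_on I (D (Suc 0))"
    by (rule continuous_on_vector_derivative[OF D])
  ultimately show ?thesis
    by (simp cong: continuous_on_cong)
qed

lemma tangent_has_derivative:
  "t \<in> I \<Longrightarrow> (T has_vector_derivative deriv_on I T t) (at t within I)"
  by (rule smooth_has_derivative[OF smooth_vec_on_if_rational[OF rational]])

lemma
  assumes t: "t \<in> I"
  shows norm_w2: "norm (w2 t) = 1" and norm_w3: "norm (w3 t) = 1"
    and frame_dots:
      "w2 t \<bullet> w2 t = 1" "w3 t \<bullet> w3 t = 1"
      "T t \<bullet> w2 t = 0" "w2 t \<bullet> T t = 0" "T t \<bullet> w3 t = 0" "w3 t \<bullet> T t = 0"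
      "w2 t \<bullet> w3 t = 0" "w3 t \<bullet> w2 t = 0"
proof -
  show n: "norm (w2 t) = 1" "norm (w3 t) = 1"
    by (rule norm_helix_w2 norm_helix_w3; use unit_axis unit slope sin_nonzero t in simp)+
  show "w2 t \<bullet> w2 t = 1" "w3 t \<bullet> w3 t = 1"
    using n by (simp_all add: dot_square_norm)
  show "T t \<bullet> w2 t = 0" "T t \<bullet> w3 t = 0" "w2 t \<bullet> w3 t = 0"
    by (rule tangent_dot_helix_w2 tangent_dot_helix_w3 helix_w2_dot_w3)+
  then show "w2 t \<bullet> T t = 0" "w3 t \<bullet> T t = 0" "w3 t \<bullet> w2 t = 0"
    by (simp_all add: inner_commute)
qed

lemma frame_expansion:
  assumes t: "t \<in> I"
  shows "x = (x \<bullet> T t) *\<^sub>R T t + (x \<bullet> w2 t) *\<^sub>R w2 t + (x \<bullet> w3 t) *\<^sub>R w3 t"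
  by (rule orthonormal_expansion_3) (simp_all add: t unit norm_w2 norm_w3 frame_dots)

text \<open>The axis \<open>u\<close> is constant, so this form of \<open>w\<^sub>3\<close> reduces its derivative to that of \<open>T\<close>.\<close>

lemma w3_eq:
  assumes "t \<in> I"
  shows "w3 t = (1 / sin \<psi>) *\<^sub>R u - cot \<psi> *\<^sub>R T t"
proof -
  have "u = cos \<psi> *\<^sub>R T t + sin \<psi> *\<^sub>R w3 t"
    by (rule helix_axis_decomposition[OF unit_axis unit[OF assms] slope[OF assms] sin_nonzero])
  then have "(1 / sin \<psi>) *\<^sub>R u = (1 / sin \<psi>) *\<^sub>R (cos \<psi> *\<^sub>R T t + sin \<psi> *\<^sub>R w3 t)"
    by simp
  then show ?thesis
    using sin_nonzero by (simp add: scaleR_add_right cot_def)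
qed

text \<open>
  Differentiating the constants \<open>T \<bullet> T\<close> and \<open>T \<bullet> u\<close> shows that \<open>T'\<close> has no component along \<open>T\<close> and none
  along \<open>u\<close>. As \<open>T\<close> and \<open>w\<^sub>3\<close> span the plane of \<open>T\<close> and \<open>u\<close>, only the component along \<open>w\<^sub>2\<close> is left.
\<close>

lemma tangent_deriv:
  assumes t: "t \<in> I"
  shows "deriv_on I T t = tangent_rate t *\<^sub>R w2 t"
proof -
  let ?d = "deriv_on I T t"
  note dT = tangent_has_derivative[OF t] and lim = limit_nontrivial[OF t]
  have "?d \<bullet> T t + T t \<bullet> ?d = 0"
    by (rule has_vector_derivative_inner_constant[OF dT dT lim t, of 1])
       (simp add: dot_square_norm unit)
  then have dT0: "?d \<bullet> T t = 0"
    by (simp add: inner_commute)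
  have "?d \<bullet> u + T t \<bullet> 0 = 0"
    by (rule has_vector_derivative_inner_constant[OF dT has_vector_derivative_const lim t slope])
  then have "?d \<bullet> w3 t = 0"
    by (simp add: w3_eq[OF t] inner_diff_right dT0)
  then show ?thesis
    using frame_expansion[OF t, of ?d] dT0 by (simp add: tangent_rate_def)
qed

lemma w2_has_derivative:
  assumes t: "t \<in> I"
  shows "(w2 has_vector_derivative tangent_rate t *\<^sub>R (cot \<psi> *\<^sub>R w3 t - T t)) (at t within I)"
proof -
  have u_T: "u \<bullet> T t = cos \<psi>"
    using slope[OF t] by (simp add: inner_commute)
  have "helix_w2 u \<psi> (w2 t) = (1 / (sin \<psi>)\<^sup>2) *\<^sub>R (cos \<psi> *\<^sub>R u - T t)"
    using unit_axis
    by (simp add: helix_w2_def cross_mult_right Lagrange u_T dot_square_norm power2_eq_square)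
  also have "\<dots> = cot \<psi> *\<^sub>R w3 t - T t"
  proof -
    have "cot \<psi> *\<^sub>R w3 t - T t = (cot \<psi> * (1 / sin \<psi>)) *\<^sub>R u - (1 + (cot \<psi>)\<^sup>2) *\<^sub>R T t"
      unfolding w3_eq[OF t]
      by (simp add: scaleR_diff_right scaleR_add_left power2_eq_square)
    moreover have "cot \<psi> * (1 / sin \<psi>) = 1 / (sin \<psi>)\<^sup>2 * cos \<psi>"
      by (simp add: cot_def power2_eq_square)
    moreover have "1 + (cot \<psi>)\<^sup>2 = 1 / (sin \<psi>)\<^sup>2"
      using sin_nonzero by (simp add: cot_def power_divide field_simps)
    ultimately show ?thesis
      by (simp add: scaleR_diff_right)
  qed
  finally have "helix_w2 u \<psi> (deriv_on I T t) = tangent_rate t *\<^sub>R (cot \<psi> *\<^sub>R w3 t - T t)"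
    using tangent_deriv[OF t] linear_scale[OF bounded_linear.linear[OF bounded_linear_helix_w2]]
    by metis
  then show ?thesis
    using bounded_linear.has_vector_derivative[OF bounded_linear_helix_w2 tangent_has_derivative[OF t]]
    by metis
qed

lemma w3_has_derivative:
  assumes t: "t \<in> I"
  shows "(w3 has_vector_derivative (- tangent_rate t * cot \<psi>) *\<^sub>R w2 t) (at t within I)"
proof -
  have "((\<lambda>s. (1 / sin \<psi>) *\<^sub>R u - cot \<psi> *\<^sub>R T s) has_vector_derivative
          0 - cot \<psi> *\<^sub>R deriv_on I T t) (at t within I)"
    using bounded_linear.has_vector_derivative[OF bounded_linear_scaleR_right tangent_has_derivative[OF t]]
    by (intro has_vector_derivative_diff has_vector_derivative_const)
  then have "((\<lambda>s. (1 / sin \<psi>) *\<^sub>R u - cot \<psi> *\<^sub>R T s) has_vector_derivative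
          (- tangent_rate t * cot \<psi>) *\<^sub>R w2 t) (at t within I)"
    by (simp add: tangent_deriv[OF t] mult.commute)
  then show ?thesis
    by (rule has_vector_derivative_transform[OF t w3_eq, rotated])
qed

text \<open>
  If \<open>(c, d) = (cos \<theta>, sin \<theta>)\<close>, then \<open>f\<close> is \<open>w\<^sub>2\<close> rotated by \<open>\<theta>\<close> about \<open>T\<close>, and
  \<open>- d w\<^sub>2 + c w\<^sub>3\<close> is \<open>w\<^sub>3\<close> rotated likewise. The two summands are the angular velocity \<open>\<theta>'\<close> and the
  rate at which \<open>w\<^sub>2\<close>, \<open>w\<^sub>3\<close> themselves turn about \<open>T\<close>; a rotation minimizing frame makes them cancel.
\<close>

lemma rotation_rate:
  assumes t: "t \<in> I"
    and f: "\<And>s. s \<in> I \<Longrightarrow> f s = c s *\<^sub>R w2 s + d s *\<^sub>R w3 s"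
    and c: "(c has_real_derivative c') (at t within I)"
    and d: "(d has_real_derivative d') (at t within I)"
    and circle: "(c t)\<^sup>2 + (d t)\<^sup>2 = 1"
  shows "deriv_on I f t \<bullet> (- d t *\<^sub>R w2 t + c t *\<^sub>R w3 t) = c t * d' - d t * c' + cot \<psi> * tangent_rate t"
proof -
  let ?dw2 = "tangent_rate t *\<^sub>R (cot \<psi> *\<^sub>R w3 t - T t)" and ?dw3 = "(- tangent_rate t * cot \<psi>) *\<^sub>R w2 t"
  let ?n = "- d t *\<^sub>R w2 t + c t *\<^sub>R w3 t"
  have "((\<lambda>s. c s *\<^sub>R w2 s + d s *\<^sub>R w3 s) has_vector_derivative
          (c t *\<^sub>R ?dw2 + c' *\<^sub>R w2 t) + (d t *\<^sub>R ?dw3 + d' *\<^sub>R w3 t)) (at t within I)"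
    by (intro has_vector_derivative_add has_vector_derivative_scaleR c d
          w2_has_derivative[OF t] w3_has_derivative[OF t])
  then have "(f has_vector_derivative
          (c t *\<^sub>R ?dw2 + c' *\<^sub>R w2 t) + (d t *\<^sub>R ?dw3 + d' *\<^sub>R w3 t)) (at t within I)"
    by (rule has_vector_derivative_transform[OF t f, rotated])
  then have deriv: "deriv_on I f t
                      = (c t *\<^sub>R ?dw2 + c' *\<^sub>R w2 t) + (d t *\<^sub>R ?dw3 + d' *\<^sub>R w3 t)"
    by (rule deriv_on_eqI[OF t])
  note dots = frame_dots[OF t]
  have n: "w2 t \<bullet> ?n = - d t" "w3 t \<bullet> ?n = c t" "T t \<bullet> ?n = 0"
    by (simp_all add: inner_add_right inner_diff_right dots)
  have "deriv_on I f t \<bullet> ?n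
          = c t * (tangent_rate t * (cot \<psi> * c t)) - c' * d t + (tangent_rate t * cot \<psi> * d t * d t + d' * c t)"
    unfolding deriv inner_add_left inner_scaleR_left inner_diff_left n by simp
  also have "\<dots> = c t * d' - d t * c' + cot \<psi> * tangent_rate t * ((c t)\<^sup>2 + (d t)\<^sup>2)"
    by (simp add: power2_eq_square algebra_simps)
  finally show ?thesis
    using circle by simp
qed

text \<open>
  The interval is connected and \<open>tangent_rate\<close> is continuous without zeros, so the sign is the same
  at all points.
\<close>

lemma tangent_rate_sign:
  assumes regular: "\<forall>t\<in>I. deriv_on I T t \<noteq> 0"
  obtains \<sigma> :: real where "\<sigma> = 1 \<or> \<sigma> = - 1" "\<And>t. t \<in> I \<Longrightarrow> tangent_rate t = \<sigma> * norm (deriv_on I T t)"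
proof -
  have norm_eq: "norm (deriv_on I T t) = \<bar>tangent_rate t\<bar>" if "t \<in> I" for t
    using tangent_deriv[OF that] norm_w2[OF that] by simp
  have "continuous_on I w2"
    by (rule continuous_on_vector_derivative[OF w2_has_derivative])
  then have cont: "continuous_on I tangent_rate"
    unfolding tangent_rate_def
    by (intro continuous_on_inner smooth_deriv_continuous smooth_vec_on_if_rational[OF rational])
  have "is_interval (tangent_rate ` I)"
    using connected_continuous_image[OF cont] interval by (simp add: is_interval_connected_1)
  moreover have "0 \<notin> tangent_rate ` I"
    using norm_eq regular by force
  ultimately have "(\<forall>t\<in>I. 0 < tangent_rate t) \<or> (\<forall>t\<in>I. tangent_rate t < 0)"
    unfolding is_interval_1 by (smt (verit) imageI)
  then show thesis
  proof
    assume "\<forall>t\<in>I. 0 < tangent_rate t"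
    then show thesis
      using norm_eq by (intro that[of 1]) auto
  next
    assume "\<forall>t\<in>I. tangent_rate t < 0"
    then show thesis
      using norm_eq by (intro that[of "- 1"]) auto
  qed
qed

section \<open>Rational rotation minimizing frames\<close>

lemma rational_w2: "rational_vec_on I w2"
  unfolding helix_w2_def
  by (intro rational_vec_on_scaleR rational_vec_on_cross3 rational_on_const rational_vec_on_const
        rational)

lemma rational_w3: "rational_vec_on I w3"
  unfolding helix_w3_def by (intro rational_vec_on_cross3 rational rational_w2)

text \<open>
  The polynomials describe the rational circular motion \<open>(P / Q, R / Q)\<close> of the second frame vector
  relative to \<open>w\<^sub>2\<close>, \<open>w\<^sub>3\<close>; the relation \<open>c\<^sup>2 + d\<^sup>2 = 1\<close> on \<open>I\<close> becomes a polynomial identity because \<open>I\<close> is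
  infinite.
\<close>

lemma RRMF_iff_pythagorean:
  assumes tangent: "\<And>t. t \<in> I \<Longrightarrow> unit_tangent I r t = T t"
  shows "has_RRMF I r \<longleftrightarrow>
    (\<exists>P R Q :: real poly. P\<^sup>2 + R\<^sup>2 = Q\<^sup>2 \<and>
       (\<forall>t\<in>I. poly Q t \<noteq> 0 \<and>
          (poly P t * poly (pderiv R) t - poly (pderiv P) t * poly R t) / (poly Q t)\<^sup>2
            = - cot \<psi> * tangent_rate t))"
    (is "_ \<longleftrightarrow> ?pyth")
proof
  assume "has_RRMF I r"
  then obtain f1 f2 f3 where rrmf: "is_RRMF I r f1 f2 f3"
    unfolding has_RRMF_def by blast
  then have rat: "rational_vec_on I f2"
    and frame: "\<And>t. t \<in> I \<Longrightarrow> norm (f1 t) = 1 \<and> norm (f2 t) = 1 \<and> norm (f3 t) = 1 \<and>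
          f1 t \<bullet> f2 t = 0 \<and> f1 t \<bullet> f3 t = 0 \<and> f2 t \<bullet> f3 t = 0 \<and> f1 t = T t"
    and rm: "\<And>t. t \<in> I \<Longrightarrow> deriv_on I f2 t \<bullet> f3 t = 0"
    using tangent unfolding is_RRMF_def is_RMF_def adapted_frame_def by auto
  define c where "c t = f2 t \<bullet> w2 t" for t
  define d where "d t = f2 t \<bullet> w3 t" for t
  have f2: "f2 t = c t *\<^sub>R w2 t + d t *\<^sub>R w3 t" if t: "t \<in> I" for t
  proof -
    have "f2 t \<bullet> T t = 0"
      using frame[OF t] by (metis inner_commute)
    then show ?thesis
      using frame_expansion[OF t, of "f2 t"] by (simp add: c_def d_def)
  qed
  have "rational_on I c" "rational_on I d"
    unfolding c_def d_def by (intro rational_on_inner rat rational_w2 rational_w3)+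
  then obtain P R Q where PRQ: "\<forall>t\<in>I. poly Q t \<noteq> 0 \<and> c t = poly P t / poly Q t \<and> d t = poly R t / poly Q t"
    using rational_on_common_denominator by blast
  have Q: "poly Q t \<noteq> 0" and c: "c t = poly P t / poly Q t" and d: "d t = poly R t / poly Q t"
    if "t \<in> I" for t
    using PRQ that by simp_all
  have circle: "(c t)\<^sup>2 + (d t)\<^sup>2 = 1" if t: "t \<in> I" for t
  proof -
    have "f2 t \<bullet> f2 t = (c t)\<^sup>2 + (d t)\<^sup>2"
      unfolding c_def d_def
      by (subst (2) f2[OF t])
         (simp add: c_def d_def inner_add_right power2_eq_square)
    then show ?thesis
      using frame[OF t] by (simp add: dot_square_norm)
  qed
  have "P\<^sup>2 + R\<^sup>2 = Q\<^sup>2"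
  proof (rule poly_eq_if_eq_on_infinite[OF infinite_domain])
    fix t assume t: "t \<in> I"
    then show "poly (P\<^sup>2 + R\<^sup>2) t = poly (Q\<^sup>2) t"
      using circle[OF t] Q[OF t] by (simp add: c d power_divide field_simps)
  qed
  moreover have "poly Q t \<noteq> 0 \<and>
      (poly P t * poly (pderiv R) t - poly (pderiv P) t * poly R t) / (poly Q t)\<^sup>2
        = - cot \<psi> * tangent_rate t" if t: "t \<in> I" for t
  proof -
    define c' where "c' = (poly (pderiv P) t * poly Q t - poly P t * poly (pderiv Q) t) / (poly Q t)\<^sup>2"
    define d' where "d' = (poly (pderiv R) t * poly Q t - poly R t * poly (pderiv Q) t) / (poly Q t)\<^sup>2"
    let ?n = "- d t *\<^sub>R w2 t + c t *\<^sub>R w3 t"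
    have dc: "(c has_real_derivative c') (at t within I)"
      unfolding c'_def
      by (rule has_field_derivative_transform_within[OF has_real_derivative_poly_divide[OF Q[OF t]],
            of 1]) (simp_all add: t c)
    have dd: "(d has_real_derivative d') (at t within I)"
      unfolding d'_def
      by (rule has_field_derivative_transform_within[OF has_real_derivative_poly_divide[OF Q[OF t]],
            of 1]) (simp_all add: t d)
    note dots = frame_dots[OF t]
    have n: "?n \<bullet> f1 t = 0" "?n \<bullet> f2 t = 0"
      using frame[OF t]
      by (simp_all add: f2[OF t] inner_add_left inner_add_right inner_diff_left dots)
    \<comment> \<open>The orientation of the frame is unknown, so \<open>f3\<close> is \<open>?n\<close> only up to sign.\<close>
    have "?n = (?n \<bullet> f1 t) *\<^sub>R f1 t + (?n \<bullet> f2 t) *\<^sub>R f2 t + (?n \<bullet> f3 t) *\<^sub>R f3 t"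
      by (rule orthonormal_expansion_3) (use frame[OF t] in blast)+
    also have "\<dots> = (?n \<bullet> f3 t) *\<^sub>R f3 t"
      unfolding n by simp
    finally have "deriv_on I f2 t \<bullet> ?n = 0"
      using rm[OF t] by (metis inner_scaleR_right mult_zero_right)
    then have "c t * d' - d t * c' = - cot \<psi> * tangent_rate t"
      using rotation_rate[OF t f2 dc dd circle[OF t]] by simp
    then show ?thesis
      unfolding c[OF t] d[OF t] c'_def d'_def quotient_wronskian[OF Q[OF t]] using Q[OF t] by simp
  qed
  ultimately show ?pyth
    by blast
next
  assume ?pyth
  then obtain P R Q :: "real poly" where pyth: "P\<^sup>2 + R\<^sup>2 = Q\<^sup>2"
    and Q: "\<And>t. t \<in> I \<Longrightarrow> poly Q t \<noteq> 0"
    and rate: "\<And>t. t \<in> I \<Longrightarrow>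
      (poly P t * poly (pderiv R) t - poly (pderiv P) t * poly R t) / (poly Q t)\<^sup>2 = - cot \<psi> * tangent_rate t"
    by blast
  define c where "c t = poly P t / poly Q t" for t
  define d where "d t = poly R t / poly Q t" for t
  define f2 where "f2 t = c t *\<^sub>R w2 t + d t *\<^sub>R w3 t" for t
  define f3 where "f3 t = - d t *\<^sub>R w2 t + c t *\<^sub>R w3 t" for t
  have circle: "(c t)\<^sup>2 + (d t)\<^sup>2 = 1" if "t \<in> I" for t
    using arg_cong[OF pyth, of "\<lambda>p. poly p t"] Q[OF that]
    by (simp add: c_def d_def power_divide field_simps)
  have rat_c: "rational_on I c" and rat_d: "rational_on I d"
    unfolding c_def d_def by (intro rational_on_poly_divide Q; assumption)+
  have rat_md: "rational_on I (\<lambda>t. - d t)"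
    using rational_on_mult[OF rational_on_const[of I "- 1"] rat_d] by simp
  have rat2: "rational_vec_on I f2"
    unfolding f2_def
    by (intro rational_vec_on_add rational_vec_on_scaleR rat_c rat_d rational_w2 rational_w3)
  have rat3: "rational_vec_on I f3"
    unfolding f3_def
    by (intro rational_vec_on_add rational_vec_on_scaleR rat_c rat_md rational_w2 rational_w3)
  have "is_RRMF I r T f2 f3"
    unfolding is_RRMF_def is_RMF_def adapted_frame_def
  proof (intro conjI ballI rational rat2 rat3 smooth_vec_on_if_rational)
    fix t assume t: "t \<in> I"
    note dots = frame_dots[OF t]
    show "norm (T t) = 1" "T t = unit_tangent I r t"
      using unit[OF t] tangent[OF t] by simp_all
    show "T t \<bullet> f2 t = 0" "T t \<bullet> f3 t = 0" "f2 t \<bullet> f3 t = 0"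
      by (simp_all add: f2_def f3_def inner_add_left inner_add_right inner_diff_right dots)
    have "f2 t \<bullet> f2 t = 1" "f3 t \<bullet> f3 t = 1"
      using circle[OF t]
      by (simp_all add: f2_def f3_def inner_add_left inner_add_right inner_diff_left
            inner_diff_right dots power2_eq_square)
    then show "norm (f2 t) = 1" "norm (f3 t) = 1"
      by (simp_all add: norm_eq_1)
    define c' where "c' = (poly (pderiv P) t * poly Q t - poly P t * poly (pderiv Q) t) / (poly Q t)\<^sup>2"
    define d' where "d' = (poly (pderiv R) t * poly Q t - poly R t * poly (pderiv Q) t) / (poly Q t)\<^sup>2"
    have dc: "(c has_real_derivative c') (at t within I)"
      unfolding c_def c'_def by (rule has_real_derivative_poly_divide[OF Q[OF t]])
    have dd: "(d has_real_derivative d') (at t within I)"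
      unfolding d_def d'_def by (rule has_real_derivative_poly_divide[OF Q[OF t]])
    have "c t * d' - d t * c' = - cot \<psi> * tangent_rate t"
      unfolding c_def d_def c'_def d'_def quotient_wronskian[OF Q[OF t]] by (rule rate[OF t])
    then show "deriv_on I f2 t \<bullet> f3 t = 0"
      unfolding f3_def using rotation_rate[OF t f2_def dc dd circle[OF t]] by simp
  qed
  then show "has_RRMF I r"
    unfolding has_RRMF_def by blast
qed

text \<open>
  Coprimality keeps \<open>a\<^sup>2 + b\<^sup>2\<close> free of real zeros, which makes \<open>Q = a\<^sup>2 + b\<^sup>2\<close> an admissible
  denominator in the direction from right to left.
\<close>

lemma RRMF_iff_half_angle:
  assumes "\<And>t. t \<in> I \<Longrightarrow> unit_tangent I r t = T t"
  shows "has_RRMF I r \<longleftrightarrow>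
    (\<exists>a b :: real poly. coprime a b \<and>
       (\<forall>t\<in>I. (poly a t * poly (pderiv b) t - poly (pderiv a) t * poly b t)
                 / ((poly a t)\<^sup>2 + (poly b t)\<^sup>2) = - (1 / 2 * cot \<psi> * tangent_rate t)))"
    (is "_ \<longleftrightarrow> ?half")
proof
  assume "has_RRMF I r"
  then have "\<exists>P R Q :: real poly. P\<^sup>2 + R\<^sup>2 = Q\<^sup>2 \<and>
       (\<forall>t\<in>I. poly Q t \<noteq> 0 \<and>
          (poly P t * poly (pderiv R) t - poly (pderiv P) t * poly R t) / (poly Q t)\<^sup>2
            = - cot \<psi> * tangent_rate t)"
    by (simp only: RRMF_iff_pythagorean[OF assms])
  then obtain P R Q :: "real poly" where pyth: "P\<^sup>2 + R\<^sup>2 = Q\<^sup>2"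
    and rate: "\<And>t. t \<in> I \<Longrightarrow> poly Q t \<noteq> 0 \<and>
        (poly P t * poly (pderiv R) t - poly (pderiv P) t * poly R t) / (poly Q t)\<^sup>2 = - cot \<psi> * tangent_rate t"
    by blast
  obtain a b where cop: "coprime a b"
    and ab: "2 * (a * pderiv b - pderiv a * b) * Q\<^sup>2 = (P * pderiv R - pderiv P * R) * (a\<^sup>2 + b\<^sup>2)"
    using half_angle_polynomials[OF pyth] by blast
  have "(poly a t * poly (pderiv b) t - poly (pderiv a) t * poly b t) / ((poly a t)\<^sup>2 + (poly b t)\<^sup>2)
          = - (1 / 2 * cot \<psi> * tangent_rate t)" if t: "t \<in> I" for t
  proof -
    have "2 * (poly a t * poly (pderiv b) t - poly (pderiv a) t * poly b t) * (poly Q t)\<^sup>2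
            = (poly P t * poly (pderiv R) t - poly (pderiv P) t * poly R t)
                * ((poly a t)\<^sup>2 + (poly b t)\<^sup>2)"
      using arg_cong[OF ab, of "\<lambda>p. poly p t"] by simp
    then have "2 * ((poly a t * poly (pderiv b) t - poly (pderiv a) t * poly b t)
                / ((poly a t)\<^sup>2 + (poly b t)\<^sup>2))
            = (poly P t * poly (pderiv R) t - poly (pderiv P) t * poly R t) / (poly Q t)\<^sup>2"
      using coprime_sum_squares_pos[OF cop, of t] rate[OF t]
      unfolding times_divide_eq_right by (subst frac_eq_eq) auto
    then show ?thesis
      using conjunct2[OF rate[OF t]] by linarith
  qed
  then show ?half
    using cop by blast
next
  assume ?half
  then obtain a b :: "real poly" where cop: "coprime a b"
    and ab: "\<And>t. t \<in> I \<Longrightarrow> (poly a t * poly (pderiv b) t - poly (pderiv a) t * poly b t)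
                 / ((poly a t)\<^sup>2 + (poly b t)\<^sup>2) = - (1 / 2 * cot \<psi> * tangent_rate t)"
    by blast
  define P where "P = a\<^sup>2 - b\<^sup>2"
  define R where "R = 2 * a * b"
  define Q where "Q = a\<^sup>2 + b\<^sup>2"
  have pyth: "P\<^sup>2 + R\<^sup>2 = Q\<^sup>2"
    unfolding P_def R_def Q_def by (simp add: power2_eq_square algebra_simps)
  have wr: "P * pderiv R - pderiv P * R = 2 * (a * pderiv b - pderiv a * b) * Q"
    unfolding P_def R_def Q_def
    by (simp add: power2_eq_square pderiv_mult pderiv_diff pderiv_add algebra_simps)
  have rate: "poly Q t \<noteq> 0 \<and>
          (poly P t * poly (pderiv R) t - poly (pderiv P) t * poly R t) / (poly Q t)\<^sup>2
            = - cot \<psi> * tangent_rate t" if t: "t \<in> I" for t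
  proof -
    have Qt: "poly Q t = (poly a t)\<^sup>2 + (poly b t)\<^sup>2"
      by (simp add: Q_def)
    have nz: "poly Q t \<noteq> 0"
      using coprime_sum_squares_pos[OF cop, of t] unfolding Qt by (rule less_imp_neq[symmetric])
    have "poly P t * poly (pderiv R) t - poly (pderiv P) t * poly R t
            = 2 * (poly a t * poly (pderiv b) t - poly (pderiv a) t * poly b t) * poly Q t"
      using arg_cong[OF wr, of "\<lambda>p. poly p t"] by simp
    then have "(poly P t * poly (pderiv R) t - poly (pderiv P) t * poly R t) / (poly Q t)\<^sup>2
        = 2 * ((poly a t * poly (pderiv b) t - poly (pderiv a) t * poly b t) / poly Q t)"
      using nz by (simp add: power2_eq_square)
    then show ?thesis
      using ab[OF t] nz by (simp add: Qt)
  qed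
  show "has_RRMF I r"
    by (subst RRMF_iff_pythagorean) (use assms pyth rate in blast)+
qed

end

text \<open>Replacing \<open>b\<close> by \<open>- b\<close> reverses the sense of rotation.\<close>

lemma coprime_wronskian_negate:
  fixes k :: "real \<Rightarrow> real"
  assumes "\<exists>a b :: real poly. coprime a b \<and>
       (\<forall>t\<in>I. (poly a t * poly (pderiv b) t - poly (pderiv a) t * poly b t)
                 / ((poly a t)\<^sup>2 + (poly b t)\<^sup>2) = k t)"
  shows "\<exists>a b :: real poly. coprime a b \<and>
       (\<forall>t\<in>I. (poly a t * poly (pderiv b) t - poly (pderiv a) t * poly b t)
                 / ((poly a t)\<^sup>2 + (poly b t)\<^sup>2) = - k t)"
proof -
  obtain a b :: "real poly" where cop: "coprime a b"
    and ab: "\<And>t. t \<in> I \<Longrightarrow> (poly a t * poly (pderiv b) t - poly (pderiv a) t * poly b t)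
                 / ((poly a t)\<^sup>2 + (poly b t)\<^sup>2) = k t"
    using assms by blast
  show ?thesis
  proof (rule exI[of _ a], rule exI[of _ "- b"], intro conjI ballI)
    show "coprime a (- b)"
      using cop by simp
    fix t assume "t \<in> I"
    have "(poly a t * poly (pderiv (- b)) t - poly (pderiv a) t * poly (- b) t)
              / ((poly a t)\<^sup>2 + (poly (- b) t)\<^sup>2)
            = - ((poly a t * poly (pderiv b) t - poly (pderiv a) t * poly b t)
                  / ((poly a t)\<^sup>2 + (poly b t)\<^sup>2))"
      unfolding minus_divide_left by (simp add: pderiv_minus)
    then show "(poly a t * poly (pderiv (- b)) t - poly (pderiv a) t * poly (- b) t)
              / ((poly a t)\<^sup>2 + (poly (- b) t)\<^sup>2) = - k t"
      using ab[OF \<open>t \<in> I\<close>] by simp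
  qed
qed

theorem proposition4:
  fixes I :: "real set" and r :: "real \<Rightarrow> real^3" and u :: "real^3" and \<psi> :: real
    and a1 a2 a3 :: "real \<Rightarrow> real"
  assumes "is_interval I" and "interior I \<noteq> {}"
    and "rational_helix I r"
    and "rational_vec_on I (unit_tangent I r)"
    and "\<forall>t\<in>I. deriv_on I (unit_tangent I r) t \<noteq> 0"
    and "norm u = 1" and "0 < \<psi>" and "\<psi> < pi"
    and "\<forall>t\<in>I. unit_tangent I r t \<bullet> u = cos \<psi>"
    and "\<forall>t\<in>I. r t = a1 t *\<^sub>R unit_tangent I r t
                   + a2 t *\<^sub>R helix_w2 u \<psi> (unit_tangent I r t)
                   + a3 t *\<^sub>R helix_w3 u \<psi> (unit_tangent I r t)"
  shows "has_RRMF I r \<longleftrightarrow>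
    (\<exists>a b :: real poly. coprime a b \<and>
       (\<forall>t\<in>I. (poly a t * poly (pderiv b) t - poly (pderiv a) t * poly b t)
                 / ((poly a t)\<^sup>2 + (poly b t)\<^sup>2)
               = 1 / 2 * cot \<psi> * norm (deriv_on I (unit_tangent I r) t)))"
proof -
  have unit: "norm (unit_tangent I r t) = 1" if "t \<in> I" for t
    using assms(3) that by (simp add: rational_helix_def unit_tangent_def)
  interpret constant_slope I "unit_tangent I r" u \<psi>
    using assms unit by unfold_locales auto
  let ?k = "\<lambda>t. 1 / 2 * cot \<psi> * norm (deriv_on I (unit_tangent I r) t)"
  obtain \<sigma> :: real where \<sigma>: "\<sigma> = 1 \<or> \<sigma> = - 1"
    and rate: "\<And>t. t \<in> I \<Longrightarrow> tangent_rate t = \<sigma> * norm (deriv_on I (unit_tangent I r) t)"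
    using tangent_rate_sign[OF assms(5)] by blast
  \<comment> \<open>The sign of \<open>- k\<close> matches the theorem if \<open>T'\<close> points against \<open>w\<^sub>2\<close>; otherwise \<open>b\<close> is negated.\<close>
  from \<sigma> show ?thesis
  proof
    assume "\<sigma> = - 1"
    then show ?thesis
      unfolding RRMF_iff_half_angle[OF refl] by (simp add: rate)
  next
    assume "\<sigma> = 1"
    then have "has_RRMF I r \<longleftrightarrow>
      (\<exists>a b :: real poly. coprime a b \<and>
         (\<forall>t\<in>I. (poly a t * poly (pderiv b) t - poly (pderiv a) t * poly b t)
                   / ((poly a t)\<^sup>2 + (poly b t)\<^sup>2) = - ?k t))"
      unfolding RRMF_iff_half_angle[OF refl] by (simp add: rate)
    then show ?thesis
      using coprime_wronskian_negate[of I ?k] coprime_wronskian_negate[of I "\<lambda>t. - ?k t"] by auto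
  qed
qed

end
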